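(* Let $X$ be a locally convex Hausdorff topological vector space. Every generalized polyhedral convex set $D\subset X$ has only a finite number of faces, and all the nonempty faces of $D$ are exposed faces of $D$.
   Context: $X$ is a real locally convex Hausdorff topological vector space, $X^*$ its (continuous) dual, and $\langle x^*,x\rangle$ the value of $x^*\in X^*$ at $x\in X$. A subset $D\subset X$ is a generalized polyhedral convex set if there exist $x_i^*\in X^*$, $\alpha_i\in\mathbb{R}$, $i=1,\dots,p$, and a closed affine subspace $L\subset X$ such that $D=\{x\in X\mid x\in L,\ \langle x_i^*,x\rangle\le\alpha_i,\ i=1,\dots,p\}$. A convex subset $F$ of a convex set $C\subset X$ is a face of $C$ if for all $x^1,x^2\in C$ with $(1-\lambda)x^1+\lambda x^2\in F$ for some $\lambda\in(0,1)$ one has $x^1\in F$ and $x^2\in F$. (The empty set is a face.) A set $F$ is an exposed face of $C$ if there exists $x^*\in X^*$ such that $F=\{u\in C\mid \langle x^*,u\rangle=\inf_{x\in C}\langle x^*,x\rangle\}$ (in particular, $x^*=0$ is allowed). *)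

theory Defs
  imports "HOL-Analysis.Analysis"
begin

class topological_real_vector = real_vector + topological_ab_group_add +
  assumes tendsto_scaleR_Pair:
    "LIM x (nhds (r::real) \<times>\<^sub>F nhds a). scaleR (fst x) (snd x) :> nhds (scaleR r a)"

(* Convexity is written out because the library's convex is not available inside a class
   specification; see locally_convex_basis below. Hausdorffness is not included: combine with
   the class t2_space. *)
class locally_convex_space = topological_real_vector +
  assumes convex_nhds_basis:
    "\<lbrakk>open U; 0 \<in> U\<rbrakk> \<Longrightarrow>
      \<exists>V. open V \<and> 0 \<in> V \<and> V \<subseteq> U \<and>
        (\<forall>x\<in>V. \<forall>y\<in>V. \<forall>u\<ge>0. \<forall>v\<ge>0. u + v = 1 \<longrightarrow> scaleR u x + scaleR v y \<in> V)"

lemma locally_convex_basis: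
  fixes U :: "'a::locally_convex_space set"
  assumes "open U" "0 \<in> U"
  obtains V where "open V" "0 \<in> V" "V \<subseteq> U" "convex V"
  using convex_nhds_basis[OF assms] unfolding convex_def by blast

instance real_normed_vector \<subseteq> locally_convex_space
proof
  fix r :: real and a :: 'a
  show "LIM x (nhds r \<times>\<^sub>F nhds a). scaleR (fst x) (snd x) :> nhds (scaleR r a)"
    by (intro tendsto_scaleR filterlim_fst filterlim_snd)
next
  fix U :: "'a set"
  assume "open U" "0 \<in> U"
  then obtain e where "e > 0" "ball 0 e \<subseteq> U"
    using open_contains_ball by blast
  then show "\<exists>V. open V \<and> 0 \<in> V \<and> V \<subseteq> U \<and>
      (\<forall>x\<in>V. \<forall>y\<in>V. \<forall>u\<ge>0. \<forall>v\<ge>0. u + v = 1 \<longrightarrow> scaleR u x + scaleR v y \<in> V)"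
    using convex_ball[of "0::'a" e] unfolding convex_def
    by (intro exI[of _ "ball 0 e"]) auto
qed

definition topological_dual :: "('a::{real_vector, topological_space} \<Rightarrow> real) set" where
  "topological_dual = {f. linear f \<and> continuous_on UNIV f}"

definition generalized_polyhedral_convex ::
    "'a::{real_vector, topological_space} set \<Rightarrow> bool" where
  "generalized_polyhedral_convex D \<longleftrightarrow>
    (\<exists>L (p::nat) f (\<alpha>::nat \<Rightarrow> real).
      affine L \<and> closed L \<and> (\<forall>i\<in>{1..p}. f i \<in> topological_dual) \<and>
      D = {x. x \<in> L \<and> (\<forall>i\<in>{1..p}. f i x \<le> \<alpha> i)})"

(* The infimum is taken in the extended reals, so that it is -\<infinity> when f is unbounded below on C
   (and then F is empty) instead of an unspecified real number. The library's exposed_face_of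
   is restricted to Euclidean spaces. *)
definition exposed_face ::
    "'a::{real_vector, topological_space} set \<Rightarrow> 'a set \<Rightarrow> bool" where
  "exposed_face F C \<longleftrightarrow>
    (\<exists>f\<in>topological_dual. F = {u \<in> C. ereal (f u) = (INF x\<in>C. ereal (f x))})"

end

theory Submission
  imports Defs
begin

text \<open>Pick a point \<open>x\<close> of a nonempty face \<open>F\<close> at which the set \<open>J\<close> of active constraints is as small
  as possible. Averaging \<open>x\<close> with any other point of \<open>F\<close> shows that \<open>J\<close> is active on all of \<open>F\<close>;
  conversely, every \<open>y \<in> D\<close> at which \<open>J\<close> is active lies in \<open>F\<close>, because the segment from \<open>y\<close> to \<open>x\<close>
  can be prolonged a little beyond \<open>x\<close> inside \<open>D\<close>. So \<open>F\<close> is determined by \<open>J\<close>, and the functional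
  \<open>- (\<Sum>i\<in>J. f i)\<close> exposes it.\<close>

text \<open>By continuity at \<open>t = 0\<close>, each strict inequality survives for all small
  \<open>t > 0\<close>; since \<open>I\<close> is finite, one \<open>t\<close> serves all indices.
  This decides how far a segment may be prolonged without violating an inactive constraint.\<close>

lemma finite_strict_slack_scaling:
  fixes a b c :: "'i \<Rightarrow> real"
  assumes "finite I" and "\<And>i. i \<in> I \<Longrightarrow> a i < c i"
  obtains t where "t > 0" "\<And>i. i \<in> I \<Longrightarrow> a i + t * b i \<le> c i"
proof -
  have "\<forall>\<^sub>F t in at_right 0. \<forall>i\<in>I. a i + t * b i < c i"
  proof (intro eventually_ball_finite assms(1) ballI)
    fix i assume "i \<in> I"
    have "((\<lambda>t. a i + t * b i) \<longlongrightarrow> a i + 0 * b i) (at_right 0)"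
      by (intro tendsto_intros)
    then show "\<forall>\<^sub>F t in at_right 0. a i + t * b i < c i"
      using assms(2)[OF \<open>i \<in> I\<close>] by (intro order_tendstoD(2)) auto
  qed
  moreover have "\<forall>\<^sub>F t in at_right (0::real). t > 0"
    by (simp add: eventually_at_right_less)
  ultimately have "\<forall>\<^sub>F t in at_right 0. t > 0 \<and> (\<forall>i\<in>I. a i + t * b i < c i)"
    by eventually_elim auto
  then obtain t where "t > 0" "\<forall>i\<in>I. a i + t * b i < c i"
    using eventually_happens' trivial_limit_at_right_real by blast
  then show ?thesis
    by (intro that[of t]) (auto intro: less_imp_le)
qed

lemma face_of_polyhedral_eq_active:
  fixes L :: "'a::real_vector set" and f :: "'i \<Rightarrow> 'a \<Rightarrow> real" and \<alpha> :: "'i \<Rightarrow> real"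
  assumes L: "affine L" and I: "finite I" and lin: "\<And>i. i \<in> I \<Longrightarrow> linear (f i)"
    and D: "D = {x \<in> L. \<forall>i\<in>I. f i x \<le> \<alpha> i}"
    and F: "F face_of D" "F \<noteq> {}"
  obtains J where "J \<subseteq> I" "F = {x \<in> D. \<forall>i\<in>J. f i x = \<alpha> i}"
proof -
  define A where "A x = {i \<in> I. f i x = \<alpha> i}" for x
  obtain x where x: "x \<in> F" and min: "\<And>y. y \<in> F \<Longrightarrow> card (A x) \<le> card (A y)"
    using F(2) ex_has_least_nat[of "\<lambda>y. y \<in> F" _ "\<lambda>y. card (A y)"] by blast
  have FD: "F \<subseteq> D" and "convex F"
    using F(1) by (auto simp: face_of_def)
  have "F = {y \<in> D. \<forall>i\<in>A x. f i y = \<alpha> i}"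
  proof (intro equalityI subsetI)
    fix y assume y: "y \<in> F"
    define m where "m = (1/2) *\<^sub>R x + (1/2) *\<^sub>R y"
    have m: "m \<in> F"
      using convexD[OF \<open>convex F\<close> x y, of "1/2" "1/2"] by (simp add: m_def)
    \<comment> \<open>Two numbers bounded by \<open>\<alpha> i\<close> whose average equals
      \<open>\<alpha> i\<close> are both equal to it.\<close>
    have "A m \<subseteq> A x \<inter> A y"
    proof
      fix i assume i: "i \<in> A m"
      then have "f i x \<le> \<alpha> i" "f i y \<le> \<alpha> i" "f i x / 2 + f i y / 2 = \<alpha> i"
        using x y FD lin[of i] by (auto simp: A_def D m_def linear_add linear_scale)
      then show "i \<in> A x \<inter> A y"
        using i by (auto simp: A_def)
    qed
    \<comment> \<open>\<open>A m\<close> is contained in \<open>A x\<close> and, by the minimal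
      choice of \<open>x\<close>, has no fewer elements. Hence \<open>A x\<close> is contained in
      \<open>A y\<close>.\<close>
    moreover have "A m = A x"
      using calculation min[OF m] I card_seteq[of "A x" "A m"] by (auto simp: A_def)
    ultimately show "y \<in> {y \<in> D. \<forall>i\<in>A x. f i y = \<alpha> i}"
      using y FD by (auto simp: A_def)
  next
    fix y assume y: "y \<in> {y \<in> D. \<forall>i\<in>A x. f i y = \<alpha> i}"
    show "y \<in> F"
    proof (cases "y = x")
      case False
      obtain t where t: "t > 0"
        and slack: "\<And>i. i \<in> I - A x \<Longrightarrow> f i x + t * (f i x - f i y) \<le> \<alpha> i"
      proof (rule finite_strict_slack_scaling[of "I - A x" "\<lambda>i. f i x" \<alpha> "\<lambda>i. f i x - f i y"])
        show "f i x < \<alpha> i" if "i \<in> I - A x" for i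
          using that x FD by (force simp: A_def D)
      qed (use I in auto)
      \<comment> \<open>\<open>z\<close> is \<open>x + t (x - y)\<close>, the prolongation beyond
        \<open>x\<close>. Its coefficients sum to 1, which keeps it in \<open>L\<close>.\<close>
      define z where "z = (1 + t) *\<^sub>R x + (- t) *\<^sub>R y"
      have fz: "f i z = f i x + t * (f i x - f i y)" if "i \<in> I" for i
        using lin[OF that] by (simp add: z_def linear_add linear_diff linear_scale algebra_simps)
      have "z \<in> L"
        unfolding z_def using x y FD by (intro mem_affine[OF L]) (auto simp: D)
      \<comment> \<open>A constraint in \<open>A x\<close> is active at both \<open>x\<close> and
        \<open>y\<close>, hence constant along their line; the others are controlled by the choice
        of \<open>t\<close>.\<close>
      moreover have "f i z \<le> \<alpha> i" if "i \<in> I" for i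
        using that y slack[of i] by (cases "i \<in> A x") (auto simp: fz A_def)
      ultimately have "z \<in> D"
        by (simp add: D)
      have "(1 + t) *\<^sub>R x = t *\<^sub>R y + z"
        by (simp add: z_def)
      then have "x = (1 / (1 + t)) *\<^sub>R (t *\<^sub>R y + z)"
        using t by (metis add_pos_pos divide_self_if less_irrefl mult.commute scaleR_one
            scaleR_scaleR times_divide_eq_right mult_1_right zero_less_one)
      then have "x = (1 - 1 / (1 + t)) *\<^sub>R y + (1 / (1 + t)) *\<^sub>R z"
        using t by (simp add: scaleR_add_right divide_simps)
      \<comment> \<open>An open segment with equal end points is empty, so distinctness is required
        before the face property can be applied.\<close>
      moreover have "y \<noteq> z"
      proof
        assume "y = z"
        then have "(1 + t) *\<^sub>R (x - y) = 0"
          by (simp add: z_def algebra_simps)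
        then show False
          using False t by simp
      qed
      ultimately have "x \<in> open_segment y z"
        using t unfolding in_segment by (intro conjI exI[of _ "1 / (1 + t)"]) auto
      then show "y \<in> F"
        using face_ofD[OF F(1) _ _ _ x] y \<open>z \<in> D\<close> by blast
    qed (use x in simp)
  qed
  then show ?thesis
    by (intro that[of "A x"]) (auto simp: A_def)
qed

text \<open>The slacks \<open>\<alpha> i - f i x\<close> are nonnegative on \<open>D\<close>, so
  their sum vanishes exactly where each of them does. The sum is negated because exposed faces are
  defined by minimization; for empty \<open>J\<close> it is the zero functional and \<open>F\<close>
  is \<open>D\<close>.\<close>

lemma exposed_face_active:
  fixes f :: "'i \<Rightarrow> 'a::{real_vector, topological_space} \<Rightarrow> real"
  assumes "finite J" and dual: "\<And>i. i \<in> J \<Longrightarrow> f i \<in> topological_dual"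
    and le: "\<And>i x. i \<in> J \<Longrightarrow> x \<in> D \<Longrightarrow> f i x \<le> \<alpha> i"
    and F: "F = {x \<in> D. \<forall>i\<in>J. f i x = \<alpha> i}" "F \<noteq> {}"
  shows "exposed_face F D"
proof -
  define g where "g x = - (\<Sum>i\<in>J. f i x)" for x
  define c where "c = - (\<Sum>i\<in>J. \<alpha> i)"
  have "linear g"
    using dual unfolding g_def topological_dual_def
    by (intro linear_compose_neg linear_compose_sum) auto
  moreover have "continuous_on UNIV g"
    using dual unfolding g_def topological_dual_def by (intro continuous_intros) auto
  ultimately have "g \<in> topological_dual"
    by (simp add: topological_dual_def)
  have ge: "c \<le> g x" if "x \<in> D" for x
    using that le by (auto simp: c_def g_def intro: sum_mono)
  have eq: "g x = c \<longleftrightarrow> x \<in> F" if "x \<in> D" for x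
  proof
    assume "g x = c"
    then have "(\<Sum>i\<in>J. \<alpha> i - f i x) = 0"
      by (simp add: g_def c_def sum_subtractf)
    then have "\<forall>i\<in>J. \<alpha> i - f i x = 0"
      using that le \<open>finite J\<close> by (subst (asm) sum_nonneg_eq_0_iff) auto
    then show "x \<in> F"
      using that by (auto simp: F)
  qed (simp add: F g_def c_def)
  \<comment> \<open>Nonemptiness of \<open>F\<close> makes the lower bound \<open>c\<close>
    attained, so it is the infimum.\<close>
  obtain u where u: "u \<in> D" "g u = c"
    using F eq by blast
  have "(INF x\<in>D. ereal (g x)) = ereal c"
  proof (rule antisym)
    show "(INF x\<in>D. ereal (g x)) \<le> ereal c"
      using u by (intro INF_lower2[of u]) auto
    show "ereal c \<le> (INF x\<in>D. ereal (g x))"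
      using ge by (intro INF_greatest) simp
  qed
  then have "F = {x \<in> D. ereal (g x) = (INF x\<in>D. ereal (g x))}"
    using eq F(1) by auto
  with \<open>g \<in> topological_dual\<close> show ?thesis
    unfolding exposed_face_def by blast
qed

theorem theorem2p4:
  fixes D :: "'a::{locally_convex_space, t2_space} set"
  assumes "generalized_polyhedral_convex D"
  shows "finite {F. F face_of D} \<and> (\<forall>F. F face_of D \<and> F \<noteq> {} \<longrightarrow> exposed_face F D)"
proof -
  obtain L f \<alpha> and p :: nat where L: "affine L" and dual: "\<And>i. i \<in> {1..p} \<Longrightarrow> f i \<in> topological_dual"
    and D: "D = {x \<in> L. \<forall>i\<in>{1..p}. f i x \<le> \<alpha> i}"
    using assms unfolding generalized_polyhedral_convex_def by blast
  have active: "\<exists>J\<subseteq>{1..p}. F = {x \<in> D. \<forall>i\<in>J. f i x = \<alpha> i}" if "F face_of D" "F \<noteq> {}" for F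
  proof -
    have "linear (f i)" if "i \<in> {1..p}" for i
      using dual[OF that] by (simp add: topological_dual_def)
    from face_of_polyhedral_eq_active[OF L _ this D that] show ?thesis
      by blast
  qed
  \<comment> \<open>The empty face is inserted separately, as only nonempty faces are known to be
    cut out by a set of active constraints.\<close>
  have "{F. F face_of D} \<subseteq> insert {} ((\<lambda>J. {x \<in> D. \<forall>i\<in>J. f i x = \<alpha> i}) ` Pow {1..p})"
    using active by blast
  then have "finite {F. F face_of D}"
    by (rule finite_subset) simp
  moreover have "exposed_face F D" if F: "F face_of D" "F \<noteq> {}" for F
  proof -
    obtain J where J: "J \<subseteq> {1..p}" "F = {x \<in> D. \<forall>i\<in>J. f i x = \<alpha> i}"
      using active[OF F] by blast
    show ?thesis
    proof (rule exposed_face_active[OF _ _ _ J(2) F(2)])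
      show "finite J"
        using J(1) finite_subset by blast
    qed (use J(1) dual D in auto)
  qed
  ultimately show ?thesis
    by blast
qed

end
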